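(* Let $X=(X_n)_{n\ge0}$ be a Galton-Watson process with $X_0=1$ and family-size distribution $\hat\pi$ on $\mathbb{N}_0$, and let $\hat\varphi_n(q)=\mathbb{E}(1-e^{-qX_n})$ be its Bernstein transform. Then for all $n\ge 0$ and all $q\ge0$, $$\hat\varphi_{n+1}(q)-\hat\varphi_n(q)=-\hat\Psi(\hat\varphi_n(q)),$$ where $$\hat\Psi(s)=\sum_{j=0}^\infty(1-s)^j\hat\pi(j)-1+s=G(1-s)-1+s$$ and $G(z)=\sum_{j\ge0}\hat\pi(j)z^j$ is the generating function of $\hat\pi$.
   Context: $\mathbb{N}_0=\{0,1,2,\dots\}$. Galton-Watson process: $X_{n+1}=\sum_{k=1}^{X_n}\xi_{k,n+1}$ with $\{\xi_{i,j}\}$ independent, identically distributed with law $\hat\pi$. *)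

theory Defs
  imports "HOL-Probability.Probability"
begin

text \<open>
  \<open>\<xi> k n\<close> is the number of children of the \<open>k\<close>-th individual of generation \<open>n - 1\<close>; both indices
  start at 1, and values of \<open>\<xi>\<close> at index 0 are irrelevant. The process starts from the
  deterministic population \<open>x\<close>.
\<close>

definition galton_watson ::
  "'a measure \<Rightarrow> nat pmf \<Rightarrow> (nat \<Rightarrow> nat \<Rightarrow> 'a \<Rightarrow> nat) \<Rightarrow> nat \<Rightarrow> (nat \<Rightarrow> 'a \<Rightarrow> nat) \<Rightarrow> bool" where
  "galton_watson M \<pi> \<xi> x X \<longleftrightarrow>
     prob_space M \<and>
     prob_space.indep_vars M (\<lambda>_. count_space UNIV) (\<lambda>(k, n). \<xi> k n) ({1..} \<times> {1..}) \<and>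
     (\<forall>k\<ge>1. \<forall>n\<ge>1. distr M (count_space UNIV) (\<xi> k n) = measure_pmf \<pi>) \<and>
     (\<forall>\<omega>\<in>space M. X 0 \<omega> = x) \<and>
     (\<forall>n. \<forall>\<omega>\<in>space M. X (Suc n) \<omega> = (\<Sum>k=1..X n \<omega>. \<xi> k (Suc n) \<omega>))"

definition bernstein_transform :: "'a measure \<Rightarrow> ('a \<Rightarrow> nat) \<Rightarrow> real \<Rightarrow> real" where
  "bernstein_transform M Y q = (\<integral>\<omega>. 1 - exp (- q * real (Y \<omega>)) \<partial>M)"

definition prob_gen_fun :: "nat pmf \<Rightarrow> real \<Rightarrow> real" where
  "prob_gen_fun \<pi> z = (\<Sum>j. pmf \<pi> j * z ^ j)"

definition branching_mechanism :: "nat pmf \<Rightarrow> real \<Rightarrow> real" where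
  "branching_mechanism \<pi> s = (\<Sum>j. (1 - s) ^ j * pmf \<pi> j) - 1 + s"

end

theory Submission
  imports Defs
begin

text \<open>
  Put \<open>z = exp (- q)\<close> and let \<open>F n z\<close> be the expectation of \<open>z ^ X n\<close>, so that the Bernstein
  transform of \<open>X n\<close> at \<open>q\<close> is \<open>1 - F n z\<close>. Write \<open>G\<close> for the generating function of the
  family size and \<open>\<Psi>\<close> for the branching mechanism. Since \<open>\<Psi> s = G (1 - s) - (1 - s)\<close>,
  the assertion becomes \<open>F (n + 1) z = G (F n z)\<close>.

  The construction of the process yields directly a different recursion. Given \<open>X n = m\<close>, the
  population \<open>X (n + 1)\<close> is a sum of \<open>m\<close> independent family sizes, which are also independent of
  \<open>X n\<close>; hence \<open>F (n + 1) z = F n (G z)\<close> (\<open>expectation_next_generation\<close>). Here \<open>G\<close> is applied to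
  the argument of \<open>F n\<close>, and not to its value. But this recursion holds for all \<open>z\<close> in the unit
  interval, which \<open>G\<close> maps into itself, so for a single ancestor \<open>F n\<close> is the \<open>n\<close>-fold iterate
  of \<open>G\<close> (\<open>expectation_generation\<close>). Iterates of \<open>G\<close> commute with \<open>G\<close>, which turns one recursion
  into the other.

  Conditional expectations are avoided by splitting every expectation along the countably many
  values of \<open>X n\<close> (\<open>expectation_sums_over_values\<close>). The independence of \<open>X n\<close> from the next
  family sizes is obtained by writing \<open>X n\<close> as a measurable function of the family sizes in the
  first \<open>n\<close> generations (\<open>galton_watson_eq_population\<close>, \<open>measurable_population\<close>), a block of
  indices disjoint from the one of generation \<open>n + 1\<close>.
\<close>

section \<open>Expectations split along a discrete variable\<close>

text \<open>
  The partial sums are the expectations of \<open>f\<close> restricted to \<open>N < n\<close>, so this is dominated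
  convergence with majorant \<open>\<bar>f\<bar>\<close>. It replaces conditioning on \<open>N\<close>.
\<close>

lemma (in prob_space) expectation_sums_over_values:
  fixes f :: "'a \<Rightarrow> real" and N :: "'a \<Rightarrow> nat"
  assumes f: "integrable M f" and N: "random_variable (count_space UNIV) N"
  shows "(\<lambda>m. expectation (\<lambda>\<omega>. indicator {m} (N \<omega>) * f \<omega>)) sums expectation f"
  unfolding sums_def
proof -
  have ind: "(\<lambda>\<omega>. indicator A (N \<omega>) :: real) \<in> borel_measurable M" for A
    by (rule measurable_compose[OF N]) simp
  have int: "integrable M (\<lambda>\<omega>. indicator {m} (N \<omega>) * f \<omega>)" for m
  proof (rule Bochner_Integration.integrable_bound[OF f])
    show "(\<lambda>\<omega>. indicator {m} (N \<omega>) * f \<omega>) \<in> borel_measurable M"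
      using f ind by (intro borel_measurable_times) auto
  qed (simp add: indicator_def)
  have "(\<lambda>n. expectation (\<lambda>\<omega>. indicator {..<n} (N \<omega>) * f \<omega>)) \<longlonglongrightarrow> expectation f"
  proof (rule integral_dominated_convergence[where w = "\<lambda>\<omega>. \<bar>f \<omega>\<bar>"])
    have "(\<lambda>n. indicator {..<n} (N \<omega>) * f \<omega>) \<longlonglongrightarrow> f \<omega>" for \<omega>
      by (intro tendsto_eventually eventually_sequentiallyI[of "Suc (N \<omega>)"]) simp
    then show "AE \<omega> in M. (\<lambda>n. indicator {..<n} (N \<omega>) * f \<omega>) \<longlonglongrightarrow> f \<omega>"
      by simp
    show "(\<lambda>\<omega>. indicator {..<n} (N \<omega>) * f \<omega>) \<in> borel_measurable M" for n
      using f ind by (intro borel_measurable_times) auto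
  qed (use f in \<open>auto simp: indicator_def\<close>)
  moreover have "expectation (\<lambda>\<omega>. indicator {..<n} (N \<omega>) * f \<omega>)
      = (\<Sum>m<n. expectation (\<lambda>\<omega>. indicator {m} (N \<omega>) * f \<omega>))" for n
  proof -
    have split: "indicator {..<n} (N \<omega>) * f \<omega> = (\<Sum>m<n. indicator {m} (N \<omega>) * f \<omega>)" for \<omega>
      by (simp add: sum_distrib_right[symmetric] indicator_def)
    show ?thesis
      unfolding split by (intro Bochner_Integration.integral_sum int)
  qed
  ultimately show "(\<lambda>n. \<Sum>m<n. expectation (\<lambda>\<omega>. indicator {m} (N \<omega>) * f \<omega>)) \<longlonglongrightarrow> expectation f"
    by simp
qed

section \<open>Probability generating functions on the unit interval\<close>

lemma (in prob_space) integrable_power: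
  fixes z :: real
  assumes z: "0 \<le> z" "z \<le> 1" and N: "N \<in> M \<rightarrow>\<^sub>M count_space UNIV"
  shows "integrable M (\<lambda>\<omega>. z ^ N \<omega>)"
proof (rule integrable_const_bound[where B = 1])
  show "AE \<omega> in M. norm (z ^ N \<omega>) \<le> 1"
    using assms by (simp add: power_le_one)
  show "(\<lambda>\<omega>. z ^ N \<omega>) \<in> borel_measurable M"
    using N by (rule measurable_compose) simp
qed

lemma (in prob_space) expectation_power_sums:
  fixes z :: real
  assumes z: "0 \<le> z" "z \<le> 1" and N: "N \<in> M \<rightarrow>\<^sub>M count_space UNIV"
  shows "(\<lambda>m. prob {\<omega> \<in> space M. N \<omega> = m} * z ^ m) sums expectation (\<lambda>\<omega>. z ^ N \<omega>)"
proof -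
  have "expectation (\<lambda>\<omega>. indicator {m} (N \<omega>) * z ^ N \<omega>) = prob {\<omega> \<in> space M. N \<omega> = m} * z ^ m" for m
  proof -
    have "expectation (\<lambda>\<omega>. indicator {m} (N \<omega>) * z ^ N \<omega>)
        = expectation (\<lambda>\<omega>. indicator {\<omega> \<in> space M. N \<omega> = m} \<omega> * z ^ m)"
      by (intro Bochner_Integration.integral_cong) (auto simp: indicator_def)
    also have "\<dots> = prob {\<omega> \<in> space M. N \<omega> = m} * z ^ m"
      by (simp add: Int_def conj_commute cong: conj_cong)
    finally show ?thesis .
  qed
  then show ?thesis
    using expectation_sums_over_values[OF integrable_power[OF assms] N] by simp
qed

lemma prob_gen_fun_eq_expectation:
  assumes "0 \<le> z" "z \<le> 1"
  shows "prob_gen_fun \<pi> z = measure_pmf.expectation \<pi> (\<lambda>j. z ^ j)"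
  using measure_pmf.expectation_power_sums[OF assms, of "\<lambda>j. j" \<pi>]
  by (simp add: prob_gen_fun_def pmf.rep_eq sums_iff)

lemma prob_gen_fun_unit_interval:
  assumes "0 \<le> z" "z \<le> 1"
  shows "0 \<le> prob_gen_fun \<pi> z" "prob_gen_fun \<pi> z \<le> 1"
proof -
  show "0 \<le> prob_gen_fun \<pi> z"
    using assms by (simp add: prob_gen_fun_eq_expectation)
  show "prob_gen_fun \<pi> z \<le> 1"
    unfolding prob_gen_fun_eq_expectation[OF assms] using assms
    by (intro measure_pmf.integral_le_const measure_pmf.integrable_power) (auto simp: power_le_one)
qed

section \<open>Generations as functions of the family sizes\<close>

text \<open>
  Separating the dynamics from the randomness of the family sizes \<open>w\<close> exposes that generation
  \<open>n\<close> depends only on the entries of \<open>w\<close> whose second index lies in \<open>{1..n}\<close>. Its independence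
  from the family sizes of generation \<open>n + 1\<close> comes from this.
\<close>

definition population :: "nat \<Rightarrow> nat \<Rightarrow> (nat \<times> nat \<Rightarrow> nat) \<Rightarrow> nat" where
  "population x n w = rec_nat x (\<lambda>i m. \<Sum>k=1..m. w (k, Suc i)) n"

lemma population_0 [simp]: "population x 0 w = x"
  and population_Suc [simp]:
    "population x (Suc n) w = (\<Sum>k=1..population x n w. w (k, Suc n))"
  by (simp_all add: population_def)

text \<open>
  The number of summands is itself random, but takes countably many values, so it suffices that
  the sum is measurable for each fixed number of summands. The index set \<open>J\<close> is a parameter
  because the induction must keep it fixed while \<open>n\<close> grows.
\<close>

lemma measurable_population:
  assumes "{1..} \<times> {1..n} \<subseteq> J"
  shows "population x n \<in> PiM J (\<lambda>_. count_space UNIV) \<rightarrow>\<^sub>M count_space UNIV"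
  using assms
proof (induction n)
  case 0
  then show ?case by simp
next
  case (Suc n)
  then have IH: "population x n \<in> PiM J (\<lambda>_. count_space UNIV) \<rightarrow>\<^sub>M count_space UNIV"
    by fastforce
  have "(\<lambda>w. \<Sum>k=1..m. w (k, Suc n))
      \<in> PiM J (\<lambda>_. count_space UNIV) \<rightarrow>\<^sub>M count_space (UNIV :: nat set)" for m
  proof (rule measurable_sum_nat)
    fix k assume "k \<in> {1..m}"
    with Suc.prems have "(k, Suc n) \<in> J" by auto
    then show "(\<lambda>w. w (k, Suc n)) \<in> PiM J (\<lambda>_. count_space UNIV) \<rightarrow>\<^sub>M count_space (UNIV :: nat set)"
      by (rule measurable_component_singleton)
  qed
  then show ?case
    unfolding population_Suc by (rule measurable_compose_countable[OF _ IH])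
qed

lemma population_cong:
  assumes "\<And>k i. 1 \<le> k \<Longrightarrow> 1 \<le> i \<Longrightarrow> i \<le> n \<Longrightarrow> v (k, i) = w (k, i)"
  shows "population x n v = population x n w"
  using assms by (induction n) simp_all

lemma galton_watson_eq_population:
  assumes gw: "galton_watson M \<pi> \<xi> x X" and "\<omega> \<in> space M"
  shows "X n \<omega> = population x n (\<lambda>(k, i). \<xi> k i \<omega>)"
  using assms by (induction n) (simp_all add: galton_watson_def)

section \<open>The branching recursion\<close>

context
  fixes M :: "'a measure" and \<pi> :: "nat pmf"
    and \<xi> :: "nat \<Rightarrow> nat \<Rightarrow> 'a \<Rightarrow> nat" and x :: nat and X :: "nat \<Rightarrow> 'a \<Rightarrow> nat"
  assumes gw: "galton_watson M \<pi> \<xi> x X"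
begin

interpretation prob_space M
  using gw by (simp add: galton_watson_def)

lemma gw_indep:
  "indep_vars (\<lambda>_. count_space UNIV) (\<lambda>p \<omega>. \<xi> (fst p) (snd p) \<omega>) ({1..} \<times> {1..})"
  using gw unfolding galton_watson_def case_prod_beta by simp

lemma measurable_offspring:
  assumes "1 \<le> k" "1 \<le> n"
  shows "\<xi> k n \<in> M \<rightarrow>\<^sub>M count_space UNIV"
  using gw_indep assms by (auto simp: indep_vars_def)

lemma measurable_generation: "X n \<in> M \<rightarrow>\<^sub>M count_space UNIV"
proof -
  have "(\<lambda>\<omega>. \<lambda>p\<in>{1..} \<times> {1..}. \<xi> (fst p) (snd p) \<omega>)
      \<in> M \<rightarrow>\<^sub>M PiM ({1..} \<times> {1..}) (\<lambda>_. count_space UNIV)"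
    by (intro measurable_restrict) (auto intro: measurable_offspring)
  then have "(\<lambda>\<omega>. population x n (\<lambda>p\<in>{1..} \<times> {1..}. \<xi> (fst p) (snd p) \<omega>))
      \<in> M \<rightarrow>\<^sub>M count_space UNIV"
    by (rule measurable_compose) (intro measurable_population, auto)
  also have "?this \<longleftrightarrow> ?thesis"
    by (intro measurable_cong)
      (auto simp: galton_watson_eq_population[OF gw] intro!: population_cong)
  finally show ?thesis .
qed

lemma expectation_offspring_power:
  fixes z :: real
  assumes z: "0 \<le> z" "z \<le> 1" and k: "1 \<le> k" "1 \<le> n"
  shows "expectation (\<lambda>\<omega>. z ^ \<xi> k n \<omega>) = prob_gen_fun \<pi> z"
proof -
  have "expectation (\<lambda>\<omega>. z ^ \<xi> k n \<omega>) = integral\<^sup>L (distr M (count_space UNIV) (\<xi> k n)) (\<lambda>j. z ^ j)"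
    using measurable_offspring[OF k] by (simp add: integral_distr)
  also have "distr M (count_space UNIV) (\<xi> k n) = measure_pmf \<pi>"
    using gw k by (simp add: galton_watson_def)
  finally show ?thesis
    by (simp add: prob_gen_fun_eq_expectation[OF z])
qed

text \<open>
  On the event \<open>X n = m\<close> the next generation is the sum of the first \<open>m\<close> family sizes with
  second index \<open>n + 1\<close>. Independence factors the contribution of this event into \<open>P (X n = m) * G z ^ m\<close>,
  and summing over \<open>m\<close> gives the expectation of \<open>G z ^ X n\<close>.
\<close>

lemma expectation_next_generation:
  fixes z :: real
  assumes z: "0 \<le> z" "z \<le> 1"
  shows "expectation (\<lambda>\<omega>. z ^ X (Suc n) \<omega>) = expectation (\<lambda>\<omega>. prob_gen_fun \<pi> z ^ X n \<omega>)"
proof -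
  let ?N = "\<lambda>\<omega>. population x n (\<lambda>(k, i). \<xi> k i \<omega>)"
  let ?S = "\<lambda>m \<omega>. \<Sum>k=1..m. \<xi> k (Suc n) \<omega>"
  let ?past = "{1..} \<times> {1..n} :: (nat \<times> nat) set"
  let ?new = "{1..} \<times> {Suc n} :: (nat \<times> nat) set"
  let ?P = "\<lambda>J. PiM J (\<lambda>_. count_space (UNIV :: nat set))"
  let ?R = "\<lambda>J \<omega>. \<lambda>p\<in>J. \<xi> (fst p) (snd p) \<omega>"
  have blocks: "indep_var (?P ?past) (?R ?past) (?P ?new) (?R ?new)"
    by (rule indep_var_restrict[OF gw_indep]) auto
  \<comment> \<open>Independence is stated for \<open>population\<close> because \<open>X n\<close> agrees with it only on \<open>space M\<close>.\<close>
  have indep: "indep_var borel (\<lambda>\<omega>. indicator {m} (?N \<omega>)) borel (\<lambda>\<omega>. z ^ ?S m \<omega>)" for m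
  proof -
    have past: "(\<lambda>w. indicator {m} (population x n w) :: real) \<in> ?P ?past \<rightarrow>\<^sub>M borel"
      by (rule measurable_compose[OF measurable_population]) auto
    have sum: "(\<lambda>w. \<Sum>k=1..m. w (k, Suc n)) \<in> ?P ?new \<rightarrow>\<^sub>M count_space UNIV"
      by (intro measurable_sum_nat measurable_component_singleton) auto
    have new: "(\<lambda>w. z ^ (\<Sum>k=1..m. w (k, Suc n))) \<in> ?P ?new \<rightarrow>\<^sub>M borel"
      by (rule measurable_compose[OF sum]) auto
    have "indep_var borel ((\<lambda>w. indicator {m} (population x n w)) \<circ> ?R ?past)
        borel ((\<lambda>w. z ^ (\<Sum>k=1..m. w (k, Suc n))) \<circ> ?R ?new)"
      by (rule indep_var_compose[OF blocks past new])
    moreover have "population x n (?R ?past \<omega>) = population x n (\<lambda>(k, i). \<xi> k i \<omega>)" for \<omega>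
      by (rule population_cong) auto
    ultimately show ?thesis
      by (simp add: comp_def)
  qed
  have offspring: "expectation (\<lambda>\<omega>. z ^ ?S m \<omega>) = prob_gen_fun \<pi> z ^ m" for m
  proof -
    \<comment> \<open>The factors stay indexed by pairs, as the independent family is, to avoid reindexing it.\<close>
    let ?J = "{1..m} \<times> {Suc n}"
    have "indep_vars (\<lambda>_. count_space UNIV) (\<lambda>p \<omega>. \<xi> (fst p) (snd p) \<omega>) ?J"
      by (rule indep_vars_subset[OF gw_indep]) auto
    then have "indep_vars (\<lambda>_. borel) (\<lambda>p \<omega>. z ^ \<xi> (fst p) (snd p) \<omega>) ?J"
      by (rule indep_vars_compose2) simp
    then have "expectation (\<lambda>\<omega>. \<Prod>p\<in>?J. z ^ \<xi> (fst p) (snd p) \<omega>)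
        = (\<Prod>p\<in>?J. expectation (\<lambda>\<omega>. z ^ \<xi> (fst p) (snd p) \<omega>))"
      using z by (intro indep_vars_lebesgue_integral integrable_power measurable_offspring) auto
    also have "\<dots> = (\<Prod>p\<in>?J. prob_gen_fun \<pi> z)"
      using z by (intro prod.cong) (auto simp: expectation_offspring_power)
    also have "\<dots> = prob_gen_fun \<pi> z ^ m"
      by simp
    also have "(\<lambda>\<omega>. \<Prod>p\<in>?J. z ^ \<xi> (fst p) (snd p) \<omega>) = (\<lambda>\<omega>. z ^ ?S m \<omega>)"
    proof
      show "(\<Prod>p\<in>?J. z ^ \<xi> (fst p) (snd p) \<omega>) = z ^ ?S m \<omega>" for \<omega>
        using prod.cartesian_product[of "\<lambda>k i. z ^ \<xi> k i \<omega>" "{Suc n}" "{1..m}"]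
        by (simp add: power_sum case_prod_beta)
    qed
    finally show ?thesis .
  qed
  have "expectation (\<lambda>\<omega>. indicator {m} (X n \<omega>) * z ^ X (Suc n) \<omega>)
      = prob {\<omega> \<in> space M. X n \<omega> = m} * prob_gen_fun \<pi> z ^ m" for m
  proof -
    have "expectation (\<lambda>\<omega>. indicator {m} (X n \<omega>) * z ^ X (Suc n) \<omega>)
        = expectation (\<lambda>\<omega>. indicator {m} (?N \<omega>) * z ^ ?S m \<omega>)"
      using gw by (intro Bochner_Integration.integral_cong)
        (auto simp: galton_watson_eq_population[OF gw] indicator_def)
    also have "\<dots> = expectation (\<lambda>\<omega>. indicator {m} (?N \<omega>)) * expectation (\<lambda>\<omega>. z ^ ?S m \<omega>)"
    proof (rule indep_var_lebesgue_integral[OF indep])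
      show "integrable M (\<lambda>\<omega>. indicator {m} (?N \<omega>) :: real)"
        by (rule integrable_const_bound[where B = 1])
          (use indep_var_rv1[OF indep] in \<open>auto simp: indicator_def\<close>)
      have "?S m \<in> M \<rightarrow>\<^sub>M count_space UNIV"
        by (intro measurable_sum_nat measurable_offspring) auto
      with z show "integrable M (\<lambda>\<omega>. z ^ ?S m \<omega>)"
        by (rule integrable_power)
    qed
    also have "expectation (\<lambda>\<omega>. indicator {m} (?N \<omega>))
        = expectation (\<lambda>\<omega>. indicator {\<omega> \<in> space M. X n \<omega> = m} \<omega>)"
      by (intro Bochner_Integration.integral_cong)
        (auto simp: galton_watson_eq_population[OF gw] indicator_def)
    also have "\<dots> = prob {\<omega> \<in> space M. X n \<omega> = m}"
      by (simp add: Int_def conj_commute cong: conj_cong)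
    finally show ?thesis
      unfolding offspring .
  qed
  then have "(\<lambda>m. prob {\<omega> \<in> space M. X n \<omega> = m} * prob_gen_fun \<pi> z ^ m)
      sums expectation (\<lambda>\<omega>. z ^ X (Suc n) \<omega>)"
    using expectation_sums_over_values[OF integrable_power[OF z measurable_generation]
        measurable_generation, of n "Suc n"] by simp
  moreover have "(\<lambda>m. prob {\<omega> \<in> space M. X n \<omega> = m} * prob_gen_fun \<pi> z ^ m)
      sums expectation (\<lambda>\<omega>. prob_gen_fun \<pi> z ^ X n \<omega>)"
    using prob_gen_fun_unit_interval[OF z] measurable_generation by (rule expectation_power_sums)
  ultimately show ?thesis
    by (rule sums_unique2)
qed

text \<open>
  The induction must vary \<open>z\<close>, since the recursion evaluates the previous generation at \<open>G z\<close>.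
  The \<open>x\<close> initial individuals found independent families, whence the exponent.
\<close>

lemma expectation_generation:
  fixes z :: real
  assumes "0 \<le> z" "z \<le> 1"
  shows "expectation (\<lambda>\<omega>. z ^ X n \<omega>) = ((prob_gen_fun \<pi> ^^ n) z) ^ x"
  using assms
proof (induction n arbitrary: z)
  case 0
  have "expectation (\<lambda>\<omega>. z ^ X 0 \<omega>) = expectation (\<lambda>\<omega>. z ^ x)"
    using gw by (intro Bochner_Integration.integral_cong) (auto simp: galton_watson_def)
  then show ?case
    by (simp add: prob_space)
next
  case (Suc n)
  then show ?case
    by (simp add: expectation_next_generation prob_gen_fun_unit_interval funpow_swap1)
qed

lemma bernstein_transform_generation:
  assumes "0 \<le> q"
  shows "bernstein_transform M (X n) q = 1 - ((prob_gen_fun \<pi> ^^ n) (exp (- q))) ^ x"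
proof -
  have z: "0 \<le> exp (- q)" "exp (- q) \<le> 1"
    using assms by auto
  have "exp (- q * real m) = exp (- q) ^ m" for m
    by (simp add: exp_of_nat_mult[symmetric] mult.commute)
  then show ?thesis
    unfolding bernstein_transform_def expectation_generation[OF z, symmetric]
    using integrable_power[OF z measurable_generation]
    by (simp add: prob_space)
qed

end

lemma branching_mechanism_eq:
  "branching_mechanism \<pi> s = prob_gen_fun \<pi> (1 - s) - 1 + s"
  by (simp add: branching_mechanism_def prob_gen_fun_def mult.commute)

theorem proposition4p2:
  fixes M :: "'a measure" and \<pi> :: "nat pmf"
    and \<xi> :: "nat \<Rightarrow> nat \<Rightarrow> 'a \<Rightarrow> nat" and X :: "nat \<Rightarrow> 'a \<Rightarrow> nat"
  assumes "galton_watson M \<pi> \<xi> 1 X"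
  shows "(\<forall>n. \<forall>q\<ge>0.
            bernstein_transform M (X (n + 1)) q - bernstein_transform M (X n) q
              = - branching_mechanism \<pi> (bernstein_transform M (X n) q))
       \<and> (\<forall>s. \<bar>1 - s\<bar> \<le> 1 \<longrightarrow> branching_mechanism \<pi> s = prob_gen_fun \<pi> (1 - s) - 1 + s)"
  using bernstein_transform_generation[OF assms] by (simp add: branching_mechanism_eq)

end
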